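(* An $R$-variety is finitely generated if and only if it is finite.
   Context: Let $\mathbb{N}$ be the set of nonnegative integers. A numerical semigroup is a subset $S\subseteq\mathbb{N}$ that is closed under addition, contains $0$, and has $\mathbb{N}\setminus S$ finite. If $S\subsetneq T$ are numerical semigroups, $\mathrm{F}_T(S)=\max(T\setminus S)$. An $R$-variety is a non-empty family $\mathcal{R}$ of numerical semigroups such that: (1) $\mathcal{R}$ has a maximum element with respect to inclusion, denoted $\Delta(\mathcal{R})$; (2) if $S,T\in\mathcal{R}$ then $S\cap T\in\mathcal{R}$; (3) if $S\in\mathcal{R}$ and $S\neq\Delta(\mathcal{R})$ then $S\cup\{\mathrm{F}_{\Delta(\mathcal{R})}(S)\}\in\mathcal{R}$. If $\mathcal{F}$ is a family of numerical semigroups and $\Delta$ is a numerical semigroup with $S\subseteq\Delta$ for all $S\in\mathcal{F}$, then $\mathcal{R}(\mathcal{F},\Delta)$ denotes the smallest $R$-variety which contains $\mathcal{F}$ and has maximum equal to $\Delta$ (it exists and equals the intersection of all $R$-varieties containing $\mathcal{F}$ with maximum $\Delta$). An $R$-variety $\mathcal{R}$ is finitely generated if there exists a finite set $\mathcal{F}\subseteq\mathcal{R}$ such that $\mathcal{R}=\mathcal{R}(\mathcal{F},\Delta(\mathcal{R}))$. *)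

theory Defs
  imports Main
begin

definition numerical_semigroup :: "nat set \<Rightarrow> bool" where
  "numerical_semigroup S \<longleftrightarrow>
     0 \<in> S \<and> (\<forall>x\<in>S. \<forall>y\<in>S. x + y \<in> S) \<and> finite (UNIV - S)"

text \<open>\<open>rel_frobenius T S\<close> is $F_T(S)$; it is meaningful only for numerical semigroups
  \<open>S \<subset> T\<close>, where \<open>T - S\<close> is finite and non-empty.\<close>

definition rel_frobenius :: "nat set \<Rightarrow> nat set \<Rightarrow> nat" where
  "rel_frobenius T S = Max (T - S)"

text \<open>The order on sets is inclusion, so \<open>Delta \<R>\<close> is the maximum of \<open>\<R>\<close> whenever
  \<open>\<R>\<close> has one.\<close>

definition Delta :: "nat set set \<Rightarrow> nat set" where
  "Delta \<R> = (GREATEST S. S \<in> \<R>)"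

definition R_variety :: "nat set set \<Rightarrow> bool" where
  "R_variety \<R> \<longleftrightarrow>
     \<R> \<noteq> {} \<and>
     (\<forall>S\<in>\<R>. numerical_semigroup S) \<and>
     (\<exists>D\<in>\<R>. \<forall>S\<in>\<R>. S \<subseteq> D) \<and>
     (\<forall>S\<in>\<R>. \<forall>T\<in>\<R>. S \<inter> T \<in> \<R>) \<and>
     (\<forall>S\<in>\<R>. S \<noteq> Delta \<R> \<longrightarrow> S \<union> {rel_frobenius (Delta \<R>) S} \<in> \<R>)"

text \<open>The smallest R-variety containing \<open>\<F>\<close> with maximum \<open>D\<close>. It exists
  when \<open>D\<close> is a numerical semigroup and every member of \<open>\<F>\<close> is a numerical semigroup
  contained in \<open>D\<close>.\<close>

definition R_variety_generated :: "nat set set \<Rightarrow> nat set \<Rightarrow> nat set set" where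
  "R_variety_generated \<F> D = (LEAST \<R>. R_variety \<R> \<and> \<F> \<subseteq> \<R> \<and> Delta \<R> = D)"

definition finitely_generated_R_variety :: "nat set set \<Rightarrow> bool" where
  "finitely_generated_R_variety \<R> \<longleftrightarrow>
     R_variety \<R> \<and> (\<exists>\<F>. finite \<F> \<and> \<F> \<subseteq> \<R> \<and> \<R> = R_variety_generated \<F> (Delta \<R>))"

end

theory Submission
  imports Defs
begin

text \<open>
  A finite \<open>R\<close>-variety generates itself, so only the converse has content. It rests on one
  observation: for a numerical semigroup \<open>D\<close> and a threshold \<open>c\<close>, the numerical semigroups lying
  between \<open>{c..}\<close> and \<open>D\<close> form an \<open>R\<close>-variety with maximum \<open>D\<close>, and this variety is finite because
  its members can differ only below \<open>c\<close>. A finite set \<open>\<F>\<close> of numerical semigroups has a common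
  threshold, since the union of their complements is finite and hence bounded. So \<open>\<F>\<close> lies in a finite
  \<open>R\<close>-variety with maximum \<open>D\<close>, which contains the one
  generated by \<open>\<F>\<close>.

  The smallest \<open>R\<close>-variety is introduced by a definite description, so bounding it also requires
  that it exists: an intersection of \<open>R\<close>-varieties with a common maximum is again one
  (\<open>R_variety_Inter\<close>).
\<close>

lemma Delta_eqI:
  assumes "D \<in> \<R>" "\<And>S. S \<in> \<R> \<Longrightarrow> S \<subseteq> D"
  shows "Delta \<R> = D"
  unfolding Delta_def by (rule Greatest_equality) (use assms in auto)

lemma
  assumes "R_variety \<R>"
  shows R_variety_Delta_in: "Delta \<R> \<in> \<R>"
    and R_variety_subset_Delta: "S \<in> \<R> \<Longrightarrow> S \<subseteq> Delta \<R>"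
proof -
  have "\<exists>D\<in>\<R>. \<forall>S\<in>\<R>. S \<subseteq> D"
    using assms unfolding R_variety_def by (elim conjE)
  then obtain D where D: "D \<in> \<R>" "\<And>S. S \<in> \<R> \<Longrightarrow> S \<subseteq> D"
    by blast
  then have "Delta \<R> = D"
    by (rule Delta_eqI)
  with D show "Delta \<R> \<in> \<R>" "S \<in> \<R> \<Longrightarrow> S \<subseteq> Delta \<R>"
    by simp_all
qed

lemma R_varietyI:
  assumes D: "D \<in> \<R>" "\<And>S. S \<in> \<R> \<Longrightarrow> S \<subseteq> D"
    and semigroup: "\<And>S. S \<in> \<R> \<Longrightarrow> numerical_semigroup S"
    and Int: "\<And>S T. S \<in> \<R> \<Longrightarrow> T \<in> \<R> \<Longrightarrow> S \<inter> T \<in> \<R>"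
    and Un_frobenius: "\<And>S. S \<in> \<R> \<Longrightarrow> S \<noteq> D \<Longrightarrow> S \<union> {rel_frobenius D S} \<in> \<R>"
  shows "R_variety \<R>"
proof -
  have Delta: "Delta \<R> = D"
    using D by (rule Delta_eqI)
  have "\<R> \<noteq> {}" "\<exists>D\<in>\<R>. \<forall>S\<in>\<R>. S \<subseteq> D"
    using D by blast+
  then show ?thesis
    unfolding R_variety_def Delta by (intro conjI ballI impI semigroup Int Un_frobenius)
qed

text \<open>
  The element added to \<open>S\<close> in the closure condition depends on the variety only through its maximum.
  With the maximum shared, all members of \<open>\<C>\<close> are therefore closed under the same operation, and
  closure passes to the intersection.
\<close>
lemma R_variety_Inter:
  assumes "\<C> \<noteq> {}" and "\<And>\<R>. \<R> \<in> \<C> \<Longrightarrow> R_variety \<R> \<and> Delta \<R> = D"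
  shows "R_variety (\<Inter>\<C>)" and "Delta (\<Inter>\<C>) = D"
proof -
  have D_in: "D \<in> \<Inter>\<C>"
    using assms R_variety_Delta_in by blast
  obtain \<R>\<^sub>0 where \<R>\<^sub>0: "\<R>\<^sub>0 \<in> \<C>" "R_variety \<R>\<^sub>0" "Delta \<R>\<^sub>0 = D"
    using assms by blast
  have D_max: "S \<subseteq> D" if "S \<in> \<Inter>\<C>" for S
    using R_variety_subset_Delta[OF \<R>\<^sub>0(2), of S] \<R>\<^sub>0 that by auto
  show "Delta (\<Inter>\<C>) = D"
    using D_in D_max by (rule Delta_eqI)
  show "R_variety (\<Inter>\<C>)"
  proof (rule R_varietyI[OF D_in D_max])
    show "numerical_semigroup S" if "S \<in> \<Inter>\<C>" for S
      using \<R>\<^sub>0(1,2) that unfolding R_variety_def by blast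
    show "S \<inter> T \<in> \<Inter>\<C>" if "S \<in> \<Inter>\<C>" "T \<in> \<Inter>\<C>" for S T
    proof (rule InterI)
      fix \<R> assume "\<R> \<in> \<C>"
      with assms(2) that have "R_variety \<R>" "S \<in> \<R>" "T \<in> \<R>"
        by blast+
      then show "S \<inter> T \<in> \<R>"
        unfolding R_variety_def by blast
    qed
    show "S \<union> {rel_frobenius D S} \<in> \<Inter>\<C>" if "S \<in> \<Inter>\<C>" "S \<noteq> D" for S
    proof (rule InterI)
      fix \<R> assume "\<R> \<in> \<C>"
      with assms(2) that have "R_variety \<R>" "Delta \<R> = D" "S \<in> \<R>"
        by blast+
      then show "S \<union> {rel_frobenius D S} \<in> \<R>"
        using \<open>S \<noteq> D\<close> unfolding R_variety_def by blast
    qed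
  qed
qed

lemma R_variety_generated_subset:
  assumes "R_variety \<Q>" "\<F> \<subseteq> \<Q>" "Delta \<Q> = D"
  shows "R_variety_generated \<F> D \<subseteq> \<Q>"
proof -
  let ?\<C> = "{\<R>. R_variety \<R> \<and> \<F> \<subseteq> \<R> \<and> Delta \<R> = D}"
  have "R_variety_generated \<F> D = \<Inter>?\<C>"
    unfolding R_variety_generated_def
  proof (rule Least_equality)
    have "R_variety (\<Inter>?\<C>)" "Delta (\<Inter>?\<C>) = D"
      by (rule R_variety_Inter; use assms in blast)+
    then show "R_variety (\<Inter>?\<C>) \<and> \<F> \<subseteq> \<Inter>?\<C> \<and> Delta (\<Inter>?\<C>) = D"
      by blast
  qed blast
  then show ?thesis
    using assms by blast
qed

lemma R_variety_generated_self:
  assumes "R_variety \<R>"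
  shows "R_variety_generated \<R> (Delta \<R>) = \<R>"
  unfolding R_variety_generated_def by (rule Least_equality) (use assms in auto)

text \<open>
  Adding any nonzero element of \<open>D\<close> to \<open>F = rel_frobenius D S\<close> gives an element of \<open>D\<close> beyond \<open>F\<close>,
  and \<open>F\<close> is the last element of \<open>D\<close> missing from \<open>S\<close>; so every new sum other than \<open>F + 0\<close>
  already lies in \<open>S\<close>.
\<close>
lemma numerical_semigroup_Un_rel_frobenius:
  assumes S: "numerical_semigroup S" and D: "numerical_semigroup D" and "S \<subset> D"
  shows "numerical_semigroup (S \<union> {rel_frobenius D S})" and "rel_frobenius D S \<in> D"
proof -
  let ?F = "rel_frobenius D S"
  have fin: "finite (D - S)"
    by (rule finite_subset[of _ "UNIV - S"]) (use S in \<open>auto simp: numerical_semigroup_def\<close>)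
  have F: "?F \<in> D - S"
    unfolding rel_frobenius_def using fin \<open>S \<subset> D\<close> by (intro Max_in) auto
  have "0 \<in> S"
    using S unfolding numerical_semigroup_def by blast
  then have "?F \<noteq> 0"
    using F by (metis DiffD2)
  have above: "?F + x \<in> S" if "x \<in> D" "x \<noteq> 0" for x
  proof (rule ccontr)
    assume "?F + x \<notin> S"
    then have "?F + x \<in> D - S"
      using D F that unfolding numerical_semigroup_def by blast
    then have "?F + x \<le> ?F"
      using fin unfolding rel_frobenius_def by (intro Max_ge)
    then show False
      using that by simp
  qed
  have sum_F: "?F + x \<in> S \<union> {?F}" "x + ?F \<in> S \<union> {?F}" if "x \<in> S \<union> {?F}" for x
    using above[of x] that F \<open>S \<subset> D\<close> \<open>?F \<noteq> 0\<close>
    by (auto simp: add.commute)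
  have "x + y \<in> S \<union> {?F}" if xy: "x \<in> S \<union> {?F}" "y \<in> S \<union> {?F}" for x y
  proof (cases "x \<in> S \<and> y \<in> S")
    case True
    then show ?thesis
      using S unfolding numerical_semigroup_def by blast
  next
    case False
    then consider "x = ?F" | "y = ?F"
      using xy by blast
    then show ?thesis
      by cases (use sum_F(1)[OF xy(2)] sum_F(2)[OF xy(1)] in simp_all)
  qed
  moreover have "finite (UNIV - (S \<union> {?F}))"
    by (rule finite_subset[of _ "UNIV - S"]) (use S in \<open>auto simp: numerical_semigroup_def\<close>)
  ultimately show "numerical_semigroup (S \<union> {?F})"
    using \<open>0 \<in> S\<close> unfolding numerical_semigroup_def by blast
  show "?F \<in> D"
    using F by blast
qed

definition semigroups_between :: "nat \<Rightarrow> nat set \<Rightarrow> nat set set" where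
  "semigroups_between c D = {S. numerical_semigroup S \<and> {c..} \<subseteq> S \<and> S \<subseteq> D}"

lemma numerical_semigroup_Int:
  assumes "numerical_semigroup S" "numerical_semigroup T"
  shows "numerical_semigroup (S \<inter> T)"
  using assms unfolding numerical_semigroup_def by (auto simp: Diff_Int)

lemma R_variety_semigroups_between:
  assumes "numerical_semigroup D" "{c..} \<subseteq> D"
  shows "R_variety (semigroups_between c D)" and "Delta (semigroups_between c D) = D"
proof -
  have D: "D \<in> semigroups_between c D"
    using assms unfolding semigroups_between_def by blast
  have D_max: "S \<subseteq> D" if "S \<in> semigroups_between c D" for S
    using that unfolding semigroups_between_def by blast
  show "Delta (semigroups_between c D) = D"
    using D D_max by (rule Delta_eqI)
  show "R_variety (semigroups_between c D)"
  proof (rule R_varietyI[OF D D_max])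
    show "S \<union> {rel_frobenius D S} \<in> semigroups_between c D"
      if "S \<in> semigroups_between c D" "S \<noteq> D" for S
      using that numerical_semigroup_Un_rel_frobenius[OF _ assms(1), of S]
      unfolding semigroups_between_def by blast
  qed (auto simp: semigroups_between_def numerical_semigroup_Int)
qed

lemma finite_semigroups_between: "finite (semigroups_between c D)"
proof (rule finite_subset)
  show "semigroups_between c D \<subseteq> (\<lambda>A. A \<union> {c..}) ` Pow {..<c}"
  proof
    fix S assume "S \<in> semigroups_between c D"
    then have "S = (S \<inter> {..<c}) \<union> {c..}"
      unfolding semigroups_between_def by (auto simp: not_less)
    then show "S \<in> (\<lambda>A. A \<union> {c..}) ` Pow {..<c}"
      by (rule image_eqI) simp
  qed
qed simp

lemma numerical_semigroups_common_threshold: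
  assumes "finite \<F>" "\<And>S. S \<in> \<F> \<Longrightarrow> numerical_semigroup S"
  shows "\<exists>c. \<forall>S\<in>\<F>. {c..} \<subseteq> S"
proof -
  have "finite (\<Union>S\<in>\<F>. UNIV - S)"
    using assms unfolding numerical_semigroup_def by blast
  then obtain c where c: "\<forall>x\<in>(\<Union>S\<in>\<F>. UNIV - S). x < c"
    using finite_nat_set_iff_bounded by blast
  show ?thesis
  proof (intro exI ballI subsetI)
    fix S x assume "S \<in> \<F>" "x \<in> {c..}"
    then have "\<not> x < c"
      by simp
    with c \<open>S \<in> \<F>\<close> show "x \<in> S"
      by blast
  qed
qed

theorem corollary5p8:
  fixes \<R> :: "nat set set"
  assumes "R_variety \<R>"
  shows "finitely_generated_R_variety \<R> \<longleftrightarrow> finite \<R>"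
proof
  assume "finitely_generated_R_variety \<R>"
  then obtain \<F> where \<F>: "finite \<F>" "\<F> \<subseteq> \<R>"
    and gen: "R_variety_generated \<F> (Delta \<R>) = \<R>"
    unfolding finitely_generated_R_variety_def by (elim conjE exE) (erule that, assumption, erule sym)
  let ?D = "Delta \<R>"
  have semigroup: "numerical_semigroup S" if "S \<in> insert ?D \<F>" for S
  proof -
    have "S \<in> \<R>"
      using that \<F>(2) R_variety_Delta_in[OF assms] by blast
    then show ?thesis
      using assms unfolding R_variety_def by simp
  qed
  \<comment> \<open>The threshold must also serve the maximum itself, which matters when \<open>\<F>\<close> is empty.\<close>
  have "finite (insert ?D \<F>)"
    using \<F>(1) by simp
  then have "\<exists>c. \<forall>S\<in>insert ?D \<F>. {c..} \<subseteq> S"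
    using semigroup by (rule numerical_semigroups_common_threshold)
  then obtain c where c: "\<forall>S\<in>insert ?D \<F>. {c..} \<subseteq> S" ..
  have "\<F> \<subseteq> semigroups_between c ?D"
  proof
    fix S assume "S \<in> \<F>"
    then have S: "S \<in> insert ?D \<F>" "S \<in> \<R>"
      using \<F>(2) by auto
    show "S \<in> semigroups_between c ?D"
      unfolding semigroups_between_def
      using semigroup[OF S(1)] bspec[OF c S(1)] R_variety_subset_Delta[OF assms S(2)] by simp
  qed
  moreover have "numerical_semigroup ?D" "{c..} \<subseteq> ?D"
    using semigroup[of ?D] bspec[OF c, of ?D] by simp_all
  ultimately have "R_variety_generated \<F> ?D \<subseteq> semigroups_between c ?D"
    by (intro R_variety_generated_subset R_variety_semigroups_between)
  then have "\<R> \<subseteq> semigroups_between c ?D"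
    unfolding gen .
  then show "finite \<R>"
    using finite_semigroups_between by (rule finite_subset)
next
  assume "finite \<R>"
  have "\<R> = R_variety_generated \<R> (Delta \<R>)"
    using assms by (rule R_variety_generated_self[symmetric])
  with assms \<open>finite \<R>\<close> show "finitely_generated_R_variety \<R>"
    unfolding finitely_generated_R_variety_def by (intro conjI exI[of _ \<R>] order_refl)
qed

end
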